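(* Let $A,B\in\mathcal{B}(\mathcal{H})$ be two positive operators such that $n\le A\le N$ and $m\le B\le M$ for some positive real numbers $n<N$ and $m<M$, and suppose that $$\left[\frac{n+m}{2},\frac{N+M}{2}\right]\cap[n,N]=\varnothing\quad\text{and}\quad\left[\frac{n+m}{2},\frac{N+M}{2}\right]\cap[m,M]=\varnothing.$$ Let $f:(0,\infty)\to[0,\infty)$ be a convex function. Then $$2f(A+B)\le f(2A)+f(2B),$$ or, equivalently (rescaling the operators), $$f\left(\frac{A+B}{2}\right)\le\frac{f(A)+f(B)}{2}.$$ If in addition $f(2t)\le2f(t)$ for all $t>0$, then $$f(A+B)\le f(A)+f(B).$$
   Context: $\mathcal{B}(\mathcal{H})$ is the algebra of bounded linear operators on a complex Hilbert space $\mathcal{H}$. An operator $A$ is positive if $\langle Ax,x\rangle\ge0$ for all $x\in\mathcal{H}$. For self-adjoint operators, $A\ge B$ means that $A-B$ is positive; for scalars $m,M$, $m\le A\le M$ means $m\langle x,x\rangle\le\langle Ax,x\rangle\le M\langle x,x\rangle$ for all $x\in\mathcal{H}$. Expressions $f(A)$ are understood via the continuous functional calculus for self-adjoint operators. Convexity of $f$ is the ordinary scalar notion. Both displayed inequalities (the one for $2f(A+B)$ and the midpoint one) are asserted to hold under the stated hypotheses. *)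

theory Defs
  imports
    "HOL-Analysis.Analysis"
    "HOL-Computational_Algebra.Polynomial"
    "HOL-Library.Complex_Order"
begin

section \<open>Complex Hilbert spaces\<close>

text \<open>
  A complex Hilbert space is modelled as its underlying real Hilbert space (so that norm, topology
  and completeness are those of the library) together with the complex scalar multiplication and
  the complex inner product, which is linear in the first argument. The norm is
  \<open>norm x = sqrt (Re (cinner x x))\<close> by \<open>inner_eq_Re_cinner\<close>; in particular
  \<open>cinner\<close> is positive definite.
\<close>

class complex_inner = real_inner +
  fixes scaleC :: "complex \<Rightarrow> 'a \<Rightarrow> 'a" (infixr "*\<^sub>C" 75)
    and cinner :: "'a \<Rightarrow> 'a \<Rightarrow> complex"
  assumes scaleC_add_right: "c *\<^sub>C (x + y) = c *\<^sub>C x + c *\<^sub>C y"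
    and scaleC_add_left: "(c + d) *\<^sub>C x = c *\<^sub>C x + d *\<^sub>C x"
    and scaleC_scaleC: "c *\<^sub>C d *\<^sub>C x = (c * d) *\<^sub>C x"
    and scaleC_of_real: "complex_of_real r *\<^sub>C x = r *\<^sub>R x"
    and cinner_commute: "cinner x y = cnj (cinner y x)"
    and cinner_add_left: "cinner (x + y) z = cinner x z + cinner y z"
    and cinner_scaleC_left: "cinner (c *\<^sub>C x) y = c * cinner x y"
    and inner_eq_Re_cinner: "inner x y = Re (cinner x y)"

class chilbert_space = complex_inner + complete_space

instantiation complex :: chilbert_space
begin

definition scaleC_complex :: "complex \<Rightarrow> complex \<Rightarrow> complex"
  where "scaleC_complex c x = c * x"

definition cinner_complex :: "complex \<Rightarrow> complex \<Rightarrow> complex"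
  where "cinner_complex x y = x * cnj y"

instance
  by standard
    (simp_all add: scaleC_complex_def cinner_complex_def algebra_simps scaleR_conv_of_real
      inner_complex_def)

end

section \<open>Bounded operators\<close>

text \<open>
  The library type \<open>'a \<Rightarrow>\<^sub>L 'a\<close> consists of the bounded real-linear maps, with the
  operator norm; \<open>bounded_operators\<close> is the subalgebra of the complex-linear ones.
\<close>

definition bounded_operators :: "('a::complex_inner \<Rightarrow>\<^sub>L 'a) set"
  where "bounded_operators = {A. \<forall>c x. blinfun_apply A (c *\<^sub>C x) = c *\<^sub>C blinfun_apply A x}"

definition selfadjoint :: "('a::complex_inner \<Rightarrow>\<^sub>L 'a) \<Rightarrow> bool"
  where "selfadjoint A \<longleftrightarrow>
    A \<in> bounded_operators \<and>
    (\<forall>x y. cinner (blinfun_apply A x) y = cinner x (blinfun_apply A y))"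

text \<open>
  The order on \<open>complex\<close> is that of \<open>Complex_Order\<close>: \<open>z \<le> w\<close> means
  \<open>Re z \<le> Re w\<close> and \<open>Im z = Im w\<close>. So below \<open>\<langle>Ax,x\<rangle>\<close> is required to be real.
\<close>

definition positive_operator :: "('a::complex_inner \<Rightarrow>\<^sub>L 'a) \<Rightarrow> bool"
  where "positive_operator A \<longleftrightarrow>
    A \<in> bounded_operators \<and> (\<forall>x. 0 \<le> cinner (blinfun_apply A x) x)"

definition operator_le :: "('a::complex_inner \<Rightarrow>\<^sub>L 'a) \<Rightarrow> ('a \<Rightarrow>\<^sub>L 'a) \<Rightarrow> bool" (infix "\<preceq>" 50)
  where "A \<preceq> B \<longleftrightarrow> selfadjoint A \<and> selfadjoint B \<and> positive_operator (B - A)"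

definition bounded_between :: "real \<Rightarrow> ('a::complex_inner \<Rightarrow>\<^sub>L 'a) \<Rightarrow> real \<Rightarrow> bool"
  where "bounded_between m A M \<longleftrightarrow>
    (\<forall>x. complex_of_real m * cinner x x \<le> cinner (blinfun_apply A x) x \<and>
         cinner (blinfun_apply A x) x \<le> complex_of_real M * cinner x x)"

section \<open>Continuous functional calculus\<close>

definition op_spectrum :: "('a::complex_inner \<Rightarrow>\<^sub>L 'a) \<Rightarrow> complex set"
  where "op_spectrum A = {z. \<not> (\<exists>S \<in> bounded_operators.
    (\<forall>x. blinfun_apply S (blinfun_apply A x - z *\<^sub>C x) = x) \<and>
    (\<forall>x. blinfun_apply A (blinfun_apply S x) - z *\<^sub>C blinfun_apply S x = x))}"

definition poly_operator :: "real poly \<Rightarrow> ('a::complex_inner \<Rightarrow>\<^sub>L 'a) \<Rightarrow> ('a \<Rightarrow>\<^sub>L 'a)"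
  where "poly_operator p A =
    (\<Sum>i\<le>degree p. coeff p i *\<^sub>R ((blinfun_compose A ^^ i) id_blinfun))"

text \<open>
  \<open>cfc f A\<close> is \<open>f(A)\<close>: the extension of the polynomial calculus to functions continuous on the
  (real) spectrum of a self-adjoint operator \<open>A\<close>, that is, the operator-norm limit of
  \<open>p\<^sub>k(A)\<close> for real polynomials \<open>p\<^sub>k\<close> converging to \<open>f\<close> uniformly on the spectrum. Such
  polynomials exist by the Weierstrass theorem, and the limit does not depend on their choice since
  the norm of \<open>p(A)\<close> is the supremum of \<open>\<bar>p\<bar>\<close> over the spectrum. Only the values of \<open>f\<close> on
  the spectrum matter; \<open>cfc f A\<close> is unspecified if \<open>f\<close> is not continuous there or \<open>A\<close> is not
  self-adjoint.
\<close>

definition cfc :: "(real \<Rightarrow> real) \<Rightarrow> ('a::complex_inner \<Rightarrow>\<^sub>L 'a) \<Rightarrow> ('a \<Rightarrow>\<^sub>L 'a)"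
  where "cfc f A = (THE T. \<exists>p :: nat \<Rightarrow> real poly.
    uniform_limit {t. complex_of_real t \<in> op_spectrum A} (\<lambda>k. poly (p k)) f sequentially \<and>
    (\<lambda>k. poly_operator (p k) A) \<longlonglongrightarrow> T)"

end

theory Submission
  imports Defs "HOL-Computational_Algebra.Fundamental_Theorem_Algebra"
begin

text \<open>
  The interval \<open>[p, q]\<close> with \<open>p = (n + m) / 2\<close> and \<open>q = (N + M) / 2\<close> contains the spectrum of
  \<open>(A + B) / 2\<close> and, by hypothesis, meets neither the spectrum of \<open>A\<close> nor that of \<open>B\<close>. The chord
  \<open>L\<close> of the convex function \<open>f\<close> over \<open>[p, q]\<close> lies above \<open>f\<close> on \<open>[p, q]\<close> and below \<open>f\<close> elsewhere, so
  \<open>f((A + B) / 2) \<le> L((A + B) / 2) = (L(A) + L(B)) / 2 \<le> (f(A) + f(B)) / 2\<close>.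
\<close>

section \<open>Complex inner products\<close>

text \<open>\<open>A\<close> and \<open>B\<close> need not commute and a convex \<open>f\<close>
  need not be operator convex, so nothing relates \<open>f((A + B) / 2)\<close> directly to
  \<open>f(A)\<close> and \<open>f(B)\<close>. An affine function can mediate because its value at a
  sum is determined linearly by the summands; the separation hypothesis lets a single chord lie
  above \<open>f\<close> for one operator and below it for the other two. The two inequalities for
  \<open>A + B\<close> use the chord over the doubled interval \<open>[n + m, N + M]\<close>.

  The analytic burden is to carry scalar inequalities over to operators and to show that the
  \<open>THE\<close> in \<open>cfc\<close> denotes something. Both rest on one fact: a real
  polynomial that is nonnegative on the spectrum of \<open>A\<close> gives a positive operator. It
  comes from factoring polynomials over the complex numbers and tracking lower bounds
  \<open>c * norm x \<le> norm (T x)\<close>. It also bounds \<open>norm (p(A))\<close> by any bound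
  of \<open>|p|\<close> on the spectrum, and this yields existence and uniqueness of the
  limit.\<close>

instance chilbert_space \<subseteq> banach ..

lemma scaleC_zero_left [simp]: "0 *\<^sub>C x = (0 :: 'a::complex_inner)"
  using scaleC_of_real[of 0 x] by simp

lemma scaleC_zero_right [simp]: "c *\<^sub>C (0 :: 'a::complex_inner) = 0"
  using scaleC_add_right[of c "0 :: 'a" 0] by simp

lemma scaleC_minus_left: "(- c) *\<^sub>C x = - (c *\<^sub>C (x :: 'a::complex_inner))"
  using scaleC_add_left[of "- c" c x] by (simp add: eq_neg_iff_add_eq_0)

lemma scaleC_sum_right: "c *\<^sub>C (\<Sum>i\<in>I. f i) = (\<Sum>i\<in>I. c *\<^sub>C (f i :: 'a::complex_inner))"
  by (induction I rule: infinite_finite_induct) (simp_all add: scaleC_add_right)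

lemma scaleC_diff_left: "(c - d) *\<^sub>C x = c *\<^sub>C x - d *\<^sub>C (x :: 'a::complex_inner)"
  using scaleC_add_left[of c "- d" x] by (simp add: scaleC_minus_left)

lemma scaleC_scaleR: "c *\<^sub>C r *\<^sub>R x = r *\<^sub>R c *\<^sub>C (x :: 'a::complex_inner)"
  by (metis mult.commute scaleC_of_real scaleC_scaleC)

lemma cinner_scaleC_right: "cinner x (c *\<^sub>C y) = cnj c * cinner x (y :: 'a::complex_inner)"
  by (metis cinner_commute cinner_scaleC_left complex_cnj_mult)

lemma cinner_add_right: "cinner x (y + z) = cinner x y + cinner x (z :: 'a::complex_inner)"
  by (metis cinner_commute cinner_add_left complex_cnj_add)

lemma cinner_self: "cinner x x = complex_of_real (x \<bullet> (x :: 'a::complex_inner))"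
proof (rule complex_eqI)
  have "cinner x x = cnj (cinner x x)"
    by (rule cinner_commute)
  then show "Im (cinner x x) = Im (complex_of_real (x \<bullet> x))"
    by (simp add: complex_eq_iff)
qed (simp add: inner_eq_Re_cinner)

lemma Im_cinner: "Im (cinner x y) = ((- \<i>) *\<^sub>C x) \<bullet> (y :: 'a::complex_inner)"
  by (simp add: inner_eq_Re_cinner cinner_scaleC_left)

lemma norm_scaleC [simp]: "norm (c *\<^sub>C x) = cmod c * norm (x :: 'a::complex_inner)"
proof -
  have "(c *\<^sub>C x) \<bullet> (c *\<^sub>C x) = Re ((c * cnj c) * cinner x x)"
    by (simp add: inner_eq_Re_cinner cinner_scaleC_left cinner_scaleC_right algebra_simps)
  also have "\<dots> = (cmod c)\<^sup>2 * (x \<bullet> x)"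
    by (simp add: complex_norm_square[symmetric] cinner_self)
  finally show ?thesis
    by (simp add: norm_eq_sqrt_inner real_sqrt_mult)
qed

lemma abs_Im_cinner_le: "\<bar>Im (cinner x y)\<bar> \<le> norm x * norm (y :: 'a::complex_inner)"
  using Cauchy_Schwarz_ineq2[of "(- \<i>) *\<^sub>C x" y] by (simp add: Im_cinner)

section \<open>Self-adjoint operators\<close>

lemma bounded_operatorsD: "A \<in> bounded_operators \<Longrightarrow> A (c *\<^sub>C x) = c *\<^sub>C A x"
  by (simp add: bounded_operators_def)

lemma bounded_operators_add:
  "A \<in> bounded_operators \<Longrightarrow> B \<in> bounded_operators \<Longrightarrow> A + B \<in> bounded_operators"
  by (simp add: bounded_operators_def blinfun.add_left scaleC_add_right)

lemma bounded_operators_scaleR: "A \<in> bounded_operators \<Longrightarrow> r *\<^sub>R A \<in> bounded_operators"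
  by (simp add: bounded_operators_def blinfun.scaleR_left scaleC_scaleR)

text \<open>A complex-linear operator that is symmetric for the real inner product is symmetric for the
  complex one, because the imaginary part of \<open>\<langle>x,y\<rangle>\<close> is the real inner product of \<open>-ix\<close> and \<open>y\<close>.\<close>

lemma selfadjoint_iff:
  "selfadjoint A \<longleftrightarrow> A \<in> bounded_operators \<and> (\<forall>x y. A x \<bullet> y = x \<bullet> A y)"
proof -
  have "cinner (A x) y = cinner x (A y)"
    if A: "A \<in> bounded_operators" and sym: "\<forall>x y. A x \<bullet> y = x \<bullet> A y" for x y
  proof (rule complex_eqI)
    show "Re (cinner (A x) y) = Re (cinner x (A y))"
      using sym by (simp flip: inner_eq_Re_cinner)
    show "Im (cinner (A x) y) = Im (cinner x (A y))"
      using sym by (simp add: Im_cinner flip: bounded_operatorsD[OF A])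
  qed
  then show ?thesis
    by (auto simp: selfadjoint_def inner_eq_Re_cinner)
qed

lemma selfadjoint_sym: "selfadjoint A \<Longrightarrow> A x \<bullet> y = x \<bullet> A y"
  by (simp add: selfadjoint_iff)

lemma selfadjoint_bounded_operators: "selfadjoint A \<Longrightarrow> A \<in> bounded_operators"
  by (simp add: selfadjoint_def)

lemma selfadjoint_add: "selfadjoint A \<Longrightarrow> selfadjoint B \<Longrightarrow> selfadjoint (A + B)"
  by (simp add: selfadjoint_iff bounded_operators_add blinfun.add_left inner_add_left
      inner_add_right)

lemma selfadjoint_scaleR: "selfadjoint A \<Longrightarrow> selfadjoint (r *\<^sub>R A)"
  by (simp add: selfadjoint_iff bounded_operators_scaleR blinfun.scaleR_left)

lemma selfadjoint_diff: "selfadjoint A \<Longrightarrow> selfadjoint B \<Longrightarrow> selfadjoint (A - B)"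
  using selfadjoint_add[of A "(-1) *\<^sub>R B"] selfadjoint_scaleR[of B "-1"] by simp

lemma selfadjoint_zero: "selfadjoint 0"
  by (simp add: selfadjoint_iff bounded_operators_def)

lemma selfadjoint_id: "selfadjoint id_blinfun"
  by (simp add: selfadjoint_iff bounded_operators_def)

lemma selfadjoint_sum: "(\<And>i. i \<in> I \<Longrightarrow> selfadjoint (f i)) \<Longrightarrow> selfadjoint (\<Sum>i\<in>I. f i)"
  by (induction I rule: infinite_finite_induct) (simp_all add: selfadjoint_zero selfadjoint_add)

text \<open>For fixed vectors and scalars, each defining equation compares two norm-continuous
  functions of \<open>A\<close>. Closedness makes the limit \<open>cfc f A\<close> inherit
  self-adjointness from its polynomial approximants.\<close>

lemma closed_selfadjoint: "closed {A. selfadjoint A}"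
proof -
  have "closed {A :: 'a \<Rightarrow>\<^sub>L 'a. \<forall>x y. A x \<bullet> y = x \<bullet> A y}"
    by (intro closed_Collect_all closed_Collect_eq continuous_on_inner blinfun.continuous_on
        continuous_on_id continuous_on_const)
  moreover have "bounded_linear (\<lambda>x :: 'a. c *\<^sub>C x)" for c
    by (rule bounded_linear_intro[where K = "cmod c"])
      (simp_all add: scaleC_add_right scaleC_scaleR)
  then have "continuous_on UNIV (\<lambda>A :: 'a \<Rightarrow>\<^sub>L 'a. c *\<^sub>C A x)" for c x
    by (rule bounded_linear.continuous_on)
      (intro blinfun.continuous_on continuous_on_id continuous_on_const)
  then have "closed {A :: 'a \<Rightarrow>\<^sub>L 'a. A (c *\<^sub>C x) = c *\<^sub>C A x}" for c x
    by (rule closed_Collect_eq[OF blinfun.continuous_on[OF continuous_on_id continuous_on_const]])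
  then have "closed {A :: 'a \<Rightarrow>\<^sub>L 'a. \<forall>c x. A (c *\<^sub>C x) = c *\<^sub>C A x}"
    by (intro closed_Collect_all)
  ultimately show ?thesis
    by (simp add: selfadjoint_iff bounded_operators_def Collect_conj_eq closed_Int)
qed

lemma selfadjoint_cinner_self: "selfadjoint A \<Longrightarrow> cinner (A x) x = complex_of_real (A x \<bullet> x)"
proof (rule complex_eqI)
  assume "selfadjoint A"
  then have "cinner (A x) x = cnj (cinner (A x) x)"
    by (metis cinner_commute selfadjoint_def)
  then show "Im (cinner (A x) x) = Im (complex_of_real (A x \<bullet> x))"
    by (simp add: complex_eq_iff)
qed (simp add: inner_eq_Re_cinner)

lemma positive_operator_iff:
  "selfadjoint A \<Longrightarrow> positive_operator A \<longleftrightarrow> (\<forall>x. 0 \<le> A x \<bullet> x)"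
  by (simp add: positive_operator_def selfadjoint_bounded_operators selfadjoint_cinner_self
      less_eq_complex_def)

lemma bounded_between_iff:
  "selfadjoint A \<Longrightarrow>
    bounded_between m A M \<longleftrightarrow> (\<forall>x. m * (x \<bullet> x) \<le> A x \<bullet> x \<and> A x \<bullet> x \<le> M * (x \<bullet> x))"
  by (simp add: bounded_between_def selfadjoint_cinner_self cinner_self less_eq_complex_def)

lemma operator_le_iff:
  "A \<preceq> B \<longleftrightarrow> selfadjoint A \<and> selfadjoint B \<and> (\<forall>x. A x \<bullet> x \<le> B x \<bullet> x)"
  by (auto simp: operator_le_def positive_operator_iff selfadjoint_diff blinfun.diff_left
      inner_diff_left)

text \<open>Polarization: the quadratic form is real at \<open>x\<close>, at \<open>y\<close> and at
  \<open>x + \<i> *\<^sub>C y\<close>, so the imaginary part of the cross terms vanishes, and that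
  part is the difference of the two real inner products to be compared.\<close>

lemma positive_operator_selfadjoint:
  assumes "positive_operator A"
  shows "selfadjoint A"
  unfolding selfadjoint_iff
proof (intro conjI allI)
  show A: "A \<in> bounded_operators"
    using assms by (simp add: positive_operator_def)
  have real: "Im (cinner (A x) x) = 0" for x
    using assms by (simp add: positive_operator_def less_eq_complex_def)
  fix x y
  have "Im (cinner (A (x + \<i> *\<^sub>C y)) (x + \<i> *\<^sub>C y)) = Re (cinner (A y) x) - Re (cinner (A x) y)"
    by (simp add: blinfun.add_right bounded_operatorsD[OF A] cinner_add_left cinner_add_right
        cinner_scaleC_left cinner_scaleC_right real)
  then show "A x \<bullet> y = x \<bullet> A y"
    by (simp add: real inner_commute[of x "A y"] flip: inner_eq_Re_cinner)
qed

text \<open>The claim is \<open>\<langle>Pz,z\<rangle> \<ge> 0\<close> for \<open>z = x - Px / K\<close>.\<close>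

lemma norm_apply_squared_le:
  assumes P: "selfadjoint P" and "\<And>x. 0 \<le> P x \<bullet> x" and le: "\<And>x. P x \<bullet> x \<le> K * (x \<bullet> x)"
  shows "(norm (P x))\<^sup>2 \<le> K * (P x \<bullet> x)"
proof (cases "P x = 0")
  case False
  have quad: "0 \<le> P x \<bullet> x + 2 * t * (P x \<bullet> P x) + t\<^sup>2 * (P (P x) \<bullet> P x)" for t
  proof -
    have "P (x + t *\<^sub>R P x) \<bullet> (x + t *\<^sub>R P x)
      = P x \<bullet> x + 2 * t * (P x \<bullet> P x) + t\<^sup>2 * (P (P x) \<bullet> P x)"
      using selfadjoint_sym[OF P, of "P x" x]
      by (simp add: blinfun.add_right blinfun.scaleR_right inner_add_left inner_add_right
          power2_eq_square algebra_simps)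
    then show ?thesis
      using assms(2)[of "x + t *\<^sub>R P x"] by simp
  qed
  have pos: "0 < P x \<bullet> P x"
    using False by simp
  \<comment> \<open>This permits \<open>t = - 1 / K\<close> below. If \<open>K \<le> 0\<close>, the
    two bounds force the quadratic form of \<open>P\<close> to vanish everywhere, and
    \<open>quad\<close> at \<open>t = - 1\<close> then reads
    \<open>0 \<le> - 2 * (P x \<bullet> P x)\<close>.\<close>
  have K: "0 < K"
  proof (rule ccontr)
    assume "\<not> 0 < K"
    then have z: "P y \<bullet> y = 0" for y
      using assms(2)[of y] le[of y] mult_nonpos_nonneg[of K "y \<bullet> y"] by simp
    show False
      using quad[of "-1"] pos by (simp add: z)
  qed
  have "0 \<le> P x \<bullet> x + 2 * (- 1 / K) * (P x \<bullet> P x) + (- 1 / K)\<^sup>2 * (P (P x) \<bullet> P x)"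
    by (rule quad)
  also have "\<dots> \<le> P x \<bullet> x + 2 * (- 1 / K) * (P x \<bullet> P x) + (- 1 / K)\<^sup>2 * (K * (P x \<bullet> P x))"
    using le[of "P x"] by (intro add_left_mono mult_left_mono) auto
  also have "\<dots> = P x \<bullet> x - (P x \<bullet> P x) / K"
    using K by (simp add: power2_eq_square field_simps)
  finally show ?thesis
    using K by (simp add: power2_norm_eq_inner field_simps)
next
  case True
  then show ?thesis by simp
qed

text \<open>The shift \<open>P = T + K\<close> lies between 0 and \<open>2 * K\<close>. Expanding
  the square in \<open>norm_apply_squared_le\<close> for \<open>P\<close>, the terms with
  \<open>T x \<bullet> x\<close> cancel, and what remains bounds \<open>norm (T x)\<close>.\<close>

lemma norm_selfadjoint_le:
  assumes T: "selfadjoint T" and "0 \<le> K" and le: "\<And>x. \<bar>T x \<bullet> x\<bar> \<le> K * (x \<bullet> x)"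
  shows "norm T \<le> K"
proof (rule norm_blinfun_bound[OF \<open>0 \<le> K\<close>])
  fix x
  let ?P = "T + K *\<^sub>R id_blinfun"
  have P: "?P y \<bullet> y = T y \<bullet> y + K * (y \<bullet> y)" for y
    by (simp add: blinfun.add_left blinfun.scaleR_left inner_add_left)
  have "(norm (?P x))\<^sup>2 \<le> (2 * K) * (?P x \<bullet> x)"
  proof (rule norm_apply_squared_le)
    show "selfadjoint ?P"
      by (intro selfadjoint_add selfadjoint_scaleR selfadjoint_id T)
    show "0 \<le> ?P y \<bullet> y" "?P y \<bullet> y \<le> 2 * K * (y \<bullet> y)" for y
      using le[of y] unfolding P by auto
  qed
  moreover have "(norm (?P x))\<^sup>2 = (norm (T x))\<^sup>2 + 2 * K * (T x \<bullet> x) + K\<^sup>2 * (norm x)\<^sup>2"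
    by (simp add: power2_norm_eq_inner blinfun.add_left blinfun.scaleR_left inner_add_left
        inner_add_right inner_commute[of x "T x"] power2_eq_square[of K] algebra_simps)
  ultimately have "(norm (T x))\<^sup>2 \<le> (K * norm x)\<^sup>2"
    unfolding P
    by (simp add: power2_norm_eq_inner[symmetric] power_mult_distrib algebra_simps
        power2_eq_square)
  then show "norm (T x) \<le> K * norm x"
    by (rule power2_le_imp_le) (simp add: \<open>0 \<le> K\<close>)
qed

section \<open>Polynomials of a self-adjoint operator\<close>

text \<open>A quantitative one-sided substitute for invertibility. It passes to compositions, so a
  product of linear factors can be treated without constructing inverses.\<close>

definition bounded_below :: "('a::real_normed_vector \<Rightarrow> 'a) \<Rightarrow> bool"
  where "bounded_below f \<longleftrightarrow> (\<exists>c>0. \<forall>x. c * norm x \<le> norm (f x))"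

lemma bounded_below_comp:
  assumes "bounded_below f" and "bounded_below g"
  shows "bounded_below (\<lambda>x. f (g x))"
proof -
  obtain c d where "0 < c" "0 < d"
    and c: "\<And>x. c * norm x \<le> norm (f x)" and d: "\<And>x. d * norm x \<le> norm (g x)"
    using assms by (auto simp: bounded_below_def)
  have "(c * d) * norm x \<le> norm (f (g x))" for x
    using mult_left_mono[OF d[of x], of c] c[of "g x"] \<open>0 < c\<close>
    unfolding mult.assoc by linarith
  then show ?thesis
    unfolding bounded_below_def using \<open>0 < c\<close> \<open>0 < d\<close> by (intro exI[of _ "c * d"]) simp
qed

lemma bounded_below_outside_spectrum:
  fixes A :: "'a::complex_inner \<Rightarrow>\<^sub>L 'a"
  assumes "z \<notin> op_spectrum A"
  shows "bounded_below (\<lambda>x. A x - z *\<^sub>C x)"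
proof -
  obtain S :: "'a \<Rightarrow>\<^sub>L 'a" where S: "S (A x - z *\<^sub>C x) = x" for x
    using assms by (auto simp: op_spectrum_def)
  \<comment> \<open>The summand 1 keeps the constant positive on the trivial space, where
    \<open>S = 0\<close>.\<close>
  have "norm x \<le> (norm S + 1) * norm (A x - z *\<^sub>C x)" for x
    using norm_blinfun[of S "A x - z *\<^sub>C x"] norm_ge_zero[of "A x - z *\<^sub>C x"]
    unfolding S distrib_right by linarith
  moreover have "0 < norm S + 1"
    by (simp add: add_nonneg_pos)
  ultimately show ?thesis
    unfolding bounded_below_def
    by (intro exI[of _ "1 / (norm S + 1)"]) (simp add: pos_divide_le_eq mult.commute)
qed

text \<open>\<open>cinner (A x) x\<close> is real, so the imaginary part of
  \<open>cinner (A x - z *\<^sub>C x) x\<close> comes from \<open>z\<close> alone; Cauchy-Schwarz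
  turns it into a lower bound with constant \<open>\<bar>Im z\<bar>\<close>.\<close>

lemma bounded_below_nonreal:
  assumes A: "selfadjoint A" and z: "Im z \<noteq> 0"
  shows "bounded_below (\<lambda>x. A x - z *\<^sub>C x)"
proof -
  have "\<bar>Im z\<bar> * norm x \<le> norm (A x - z *\<^sub>C x)" for x
  proof (cases "x = 0")
    case False
    have "cinner (A x - z *\<^sub>C x) x = cinner (A x) x - z * cinner x x"
      using cinner_add_left[of "A x - z *\<^sub>C x" "z *\<^sub>C x" x] by (simp add: cinner_scaleC_left)
    then have "\<bar>Im z\<bar> * (norm x)\<^sup>2 = \<bar>Im (cinner (A x - z *\<^sub>C x) x)\<bar>"
      by (simp add: selfadjoint_cinner_self[OF A] cinner_self abs_mult power2_norm_eq_inner)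
    also have "\<dots> \<le> norm (A x - z *\<^sub>C x) * norm x"
      by (rule abs_Im_cinner_le)
    finally show ?thesis
      using False by (simp add: power2_eq_square)
  qed simp
  then show ?thesis
    unfolding bounded_below_def using z by (intro exI[of _ "\<bar>Im z\<bar>"]) simp
qed

text \<open>Complex coefficients are needed to split a real polynomial into linear factors. The
  value is defined on vectors because the operator type carries only real scalar
  multiplication.\<close>

definition cpoly_apply :: "complex poly \<Rightarrow> ('a::complex_inner \<Rightarrow>\<^sub>L 'a) \<Rightarrow> 'a \<Rightarrow> 'a"
  where "cpoly_apply q A x = (\<Sum>i\<le>degree q. coeff q i *\<^sub>C (blinfun_apply A ^^ i) x)"

lemma cpoly_apply_eq_sum:
  assumes "degree q \<le> n"
  shows "cpoly_apply q A x = (\<Sum>i\<le>n. coeff q i *\<^sub>C (blinfun_apply A ^^ i) x)"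
  unfolding cpoly_apply_def using assms
  by (intro sum.mono_neutral_left) (auto simp: coeff_eq_0)

lemma cpoly_apply_linear_factor:
  assumes A: "A \<in> bounded_operators"
  shows "cpoly_apply ([:- z, 1:] * r) A x = A (cpoly_apply r A x) - z *\<^sub>C cpoly_apply r A x"
proof -
  define n where "n = degree r"
  let ?a = "\<lambda>i. (blinfun_apply A ^^ i) x"
  let ?s = "\<lambda>i. coeff (pCons 0 r) i"
  have "degree ([:- z, 1:] * r) \<le> Suc n"
    using degree_mult_le[of "[:- z, 1:]" r] by (simp add: n_def)
  then have "cpoly_apply ([:- z, 1:] * r) A x = (\<Sum>i\<le>Suc n. coeff ([:- z, 1:] * r) i *\<^sub>C ?a i)"
    by (rule cpoly_apply_eq_sum)
  also have "\<dots> = (\<Sum>i\<le>Suc n. ?s i *\<^sub>C ?a i) - (\<Sum>i\<le>Suc n. (z * coeff r i) *\<^sub>C ?a i)"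
    by (simp only: sum_subtractf[symmetric]) (simp add: scaleC_diff_left)
  \<comment> \<open>The top term vanishes since \<open>r\<close> has degree \<open>n\<close>; in the
    other sum the bottom term vanishes, and the index shift produces one more application of
    \<open>A\<close>.\<close>
  also have "(\<Sum>i\<le>Suc n. (z * coeff r i) *\<^sub>C ?a i) = z *\<^sub>C (\<Sum>i\<le>n. coeff r i *\<^sub>C ?a i)"
    by (simp add: scaleC_sum_right scaleC_scaleC coeff_eq_0 n_def)
  also have "(\<Sum>i\<le>Suc n. ?s i *\<^sub>C ?a i) = (\<Sum>i\<le>n. coeff r i *\<^sub>C ?a (Suc i))"
    by (subst sum.atMost_Suc_shift) simp
  also have "\<dots> = A (\<Sum>i\<le>n. coeff r i *\<^sub>C ?a i)"
    by (simp add: blinfun.sum_right bounded_operatorsD[OF A])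
  finally show ?thesis
    by (simp add: cpoly_apply_def n_def)
qed

text \<open>Induction on the degree: the fundamental theorem of algebra splits off a root, and its
  linear factor is composed with the remaining polynomial.\<close>

lemma bounded_below_cpoly_apply:
  assumes A: "A \<in> bounded_operators"
  shows "q \<noteq> 0 \<Longrightarrow> (\<And>z. poly q z = 0 \<Longrightarrow> bounded_below (\<lambda>x. A x - z *\<^sub>C x)) \<Longrightarrow>
    bounded_below (cpoly_apply q A)"
proof (induction "degree q" arbitrary: q)
  case 0
  then obtain a where "q = [:a:]" "a \<noteq> 0"
    by (metis degree_0_id of_nat_0 degree_eq_zeroE pCons_eq_0_iff)
  then show ?case
    unfolding bounded_below_def by (intro exI[of _ "cmod a"]) (simp add: cpoly_apply_def)
next
  case (Suc n)
  then have "\<not> constant (poly q)"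
    by (simp add: constant_degree)
  then obtain z where z: "poly q z = 0"
    using fundamental_theorem_of_algebra by blast
  then obtain r where q: "q = [:- z, 1:] * r"
    by (auto simp: poly_eq_0_iff_dvd elim: dvdE)
  with Suc.prems(1) have "r \<noteq> 0"
    by auto
  have "bounded_below (cpoly_apply r A)"
  proof (rule Suc.hyps(1))
    show "n = degree r"
      using Suc.hyps(2) degree_mult_eq[of "[:- z, 1:]" r] \<open>r \<noteq> 0\<close> by (simp add: q)
    show "bounded_below (\<lambda>x. A x - w *\<^sub>C x)" if "poly r w = 0" for w
      using Suc.prems(2)[of w] that by (simp add: q)
  qed fact
  then have "bounded_below (\<lambda>x. A (cpoly_apply r A x) - z *\<^sub>C cpoly_apply r A x)"
    by (rule bounded_below_comp[OF Suc.prems(2)[OF z]])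
  then show ?case
    unfolding q cpoly_apply_linear_factor[OF A, abs_def] .
qed

lemma blinfun_compose_power_apply:
  fixes A :: "'a::real_normed_vector \<Rightarrow>\<^sub>L 'a"
  shows "((blinfun_compose A ^^ i) id_blinfun) x = (blinfun_apply A ^^ i) x"
  by (induction i) auto

lemma poly_operator_eq_sum:
  assumes "degree p \<le> n"
  shows "poly_operator p A = (\<Sum>i\<le>n. coeff p i *\<^sub>R ((blinfun_compose A ^^ i) id_blinfun))"
  unfolding poly_operator_def using assms
  by (intro sum.mono_neutral_left) (auto simp: coeff_eq_0)

lemma poly_operator_apply: "poly_operator p A x = cpoly_apply (map_poly complex_of_real p) A x"
proof -
  have "degree (map_poly complex_of_real p) \<le> degree p"
    by (rule map_poly_degree_leq)
  then show ?thesis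
    by (simp add: cpoly_apply_eq_sum coeff_map_poly scaleC_of_real poly_operator_def
        blinfun.sum_left blinfun.scaleR_left blinfun_compose_power_apply)
qed

lemma poly_operator_add: "poly_operator (p + q) A = poly_operator p A + poly_operator q A"
proof -
  define n where "n = max (degree p) (degree q)"
  have "degree p \<le> n" "degree q \<le> n" "degree (p + q) \<le> n"
    by (simp_all add: n_def degree_add_le)
  then show ?thesis
    by (simp add: poly_operator_eq_sum scaleR_add_left sum.distrib)
qed

lemma poly_operator_minus: "poly_operator (- p) A = - poly_operator p A"
  by (simp add: poly_operator_def sum_negf)

lemma poly_operator_diff: "poly_operator (p - q) A = poly_operator p A - poly_operator q A"
  using poly_operator_add[of p "- q" A] by (simp add: poly_operator_minus)

lemma poly_operator_const: "poly_operator [:c:] A = c *\<^sub>R id_blinfun"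
  by (simp add: poly_operator_def)

lemma poly_operator_affine: "poly_operator [:d, c:] A = d *\<^sub>R id_blinfun + c *\<^sub>R A"
proof -
  have "A o\<^sub>L id_blinfun = A"
    by (rule blinfun_eqI) simp
  then show ?thesis
    by (simp add: poly_operator_eq_sum[of "[:d, c:]" 1])
qed

lemma selfadjoint_poly_operator:
  assumes A: "selfadjoint A"
  shows "selfadjoint (poly_operator p A)"
proof -
  have "((blinfun_apply A ^^ i) x) \<bullet> y = x \<bullet> ((blinfun_apply A ^^ i) y)" for i x y
  proof (induction i arbitrary: y)
    case (Suc i)
    then show ?case
      by (simp add: selfadjoint_sym[OF A]) (simp add: funpow_swap1)
  qed simp
  moreover have "(blinfun_apply A ^^ i) (c *\<^sub>C x) = c *\<^sub>C (blinfun_apply A ^^ i) x" for i c x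
    by (induction i) (simp_all add: bounded_operatorsD selfadjoint_bounded_operators A)
  ultimately have "selfadjoint ((blinfun_compose A ^^ i) id_blinfun)" for i
    by (simp add: selfadjoint_iff bounded_operators_def blinfun_compose_power_apply)
  then show ?thesis
    unfolding poly_operator_def by (intro selfadjoint_sum selfadjoint_scaleR)
qed

lemma poly_map_poly_of_real:
  "poly (map_poly complex_of_real p) (complex_of_real t) = complex_of_real (poly p t)"
  by (induction p) (simp_all add: map_poly_pCons)

text \<open>The infimum of the Rayleigh quotient is an approximate eigenvalue. If
  \<open>S = T - l\<close> were bounded below by \<open>c\<close>, then
  \<open>norm_apply_squared_le\<close> for the nonnegative \<open>S\<close> would raise the lower
  bound of the quotient to \<open>l + c\<^sup>2 / K\<close>. The vector \<open>v\<close> ensures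
  that the infimum is over a nonempty set.\<close>

lemma numerical_range_inf:
  fixes T :: "'a::complex_inner \<Rightarrow>\<^sub>L 'a" and v :: 'a
  assumes T: "selfadjoint T" and "v \<noteq> 0"
  obtains l where "\<And>x. l * (x \<bullet> x) \<le> T x \<bullet> x" and "\<not> bounded_below (\<lambda>x. T x - l *\<^sub>R x)"
proof
  let ?q = "\<lambda>x. (T x \<bullet> x) / (x \<bullet> x)"
  define l where "l = (INF x\<in>- {0}. ?q x)"
  have norm: "\<bar>R x \<bullet> x\<bar> \<le> norm R * (x \<bullet> x)" for R :: "'a \<Rightarrow>\<^sub>L 'a" and x
  proof -
    have "\<bar>R x \<bullet> x\<bar> \<le> norm (R x) * norm x"
      by (rule Cauchy_Schwarz_ineq2)
    also have "\<dots> \<le> norm R * norm x * norm x"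
      by (intro mult_right_mono norm_blinfun) simp
    finally show ?thesis
      by (simp add: power2_eq_square mult.assoc flip: power2_norm_eq_inner)
  qed
  have "bdd_below (?q ` (- {0}))"
  proof (rule bdd_belowI2)
    fix x :: 'a assume "x \<in> - {0}"
    then show "- norm T \<le> ?q x"
      using norm[of T x] by (simp add: pos_le_divide_eq)
  qed
  then have "l \<le> ?q x" if "x \<noteq> 0" for x
    unfolding l_def using that by (intro cINF_lower) auto
  then show l: "l * (x \<bullet> x) \<le> T x \<bullet> x" for x
    by (cases "x = 0") (auto simp: pos_le_divide_eq)
  show "\<not> bounded_below (\<lambda>x. T x - l *\<^sub>R x)"
  proof
    assume "bounded_below (\<lambda>x. T x - l *\<^sub>R x)"
    then obtain c where "0 < c" and c: "\<And>x. c * norm x \<le> norm (T x - l *\<^sub>R x)"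
      by (auto simp: bounded_below_def)
    define S where "S = T - l *\<^sub>R id_blinfun"
    \<comment> \<open>\<open>norm S\<close> already bounds the quadratic form of \<open>S\<close>;
      the summand 1 makes \<open>K\<close> positive.\<close>
    define K where "K = norm S + 1"
    have "0 < K"
      by (simp add: K_def add_nonneg_pos)
    have S: "S x = T x - l *\<^sub>R x" for x
      by (simp add: S_def blinfun.diff_left blinfun.scaleR_left)
    have Sx: "S x \<bullet> x = T x \<bullet> x - l * (x \<bullet> x)" for x
      by (simp add: S inner_diff_left)
    have ge: "l + c\<^sup>2 / K \<le> ?q x" if "x \<noteq> 0" for x
    proof -
      have "c\<^sup>2 * (x \<bullet> x) \<le> (norm (S x))\<^sup>2"
        using power_mono[OF c[of x], of 2] \<open>0 < c\<close>
        by (simp add: S power_mult_distrib power2_norm_eq_inner)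
      also have "\<dots> \<le> K * (S x \<bullet> x)"
      proof (rule norm_apply_squared_le)
        show "selfadjoint S"
          unfolding S_def by (intro selfadjoint_diff selfadjoint_scaleR selfadjoint_id T)
        show "0 \<le> S y \<bullet> y" "S y \<bullet> y \<le> K * (y \<bullet> y)" for y
          using l[of y] norm[of S y] inner_ge_zero[of y]
          by (auto simp: Sx K_def distrib_right intro: add_increasing2)
      qed
      finally show ?thesis
        using that \<open>0 < K\<close> by (simp add: Sx field_simps)
    qed
    have "- {0 :: 'a} \<noteq> {}"
      using \<open>v \<noteq> 0\<close> by auto
    then have "l + c\<^sup>2 / K \<le> (INF x\<in>- {0}. ?q x)"
      by (rule cINF_greatest) (simp add: ge)
    then show False
      using \<open>0 < c\<close> \<open>0 < K\<close> unfolding l_def[symmetric] by (simp add: field_simps)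
  qed
qed

text \<open>If \<open>\<langle>p(A)x,x\<rangle> < 0\<close>, then \<open>p - l\<close> has no zero in the spectrum for \<open>l\<close> the infimum of the
  numerical range of \<open>p(A)\<close>, so every factor \<open>A - z\<close> of \<open>p(A) - l\<close> is bounded below, which
  contradicts the choice of \<open>l\<close>. The case \<open>p = l\<close> only requires the spectrum to be nonempty.\<close>

lemma poly_operator_nonneg:
  fixes A :: "'a::complex_inner \<Rightarrow>\<^sub>L 'a"
  assumes A: "selfadjoint A"
    and p: "\<And>t. complex_of_real t \<in> op_spectrum A \<Longrightarrow> 0 \<le> poly p t"
  shows "0 \<le> poly_operator p A x \<bullet> x"
proof (rule ccontr)
  let ?T = "poly_operator p A"
  assume neg: "\<not> 0 \<le> ?T x \<bullet> x"
  then have "x \<noteq> 0"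
    by auto
  \<comment> \<open>Applied to \<open>A\<close> itself, the infimum of the numerical range is a
    point of the spectrum, which later excludes \<open>q = 0\<close>.\<close>
  obtain m where "\<not> bounded_below (\<lambda>x. A x - m *\<^sub>R x)"
    using numerical_range_inf[OF A \<open>x \<noteq> 0\<close>] by blast
  then have m: "complex_of_real m \<in> op_spectrum A"
    using bounded_below_outside_spectrum[of m A] by (auto simp: scaleC_of_real)
  obtain l where l: "\<And>y. l * (y \<bullet> y) \<le> ?T y \<bullet> y"
    and nb: "\<not> bounded_below (\<lambda>y. ?T y - l *\<^sub>R y)"
    using numerical_range_inf[OF selfadjoint_poly_operator[OF A] \<open>x \<noteq> 0\<close>] by blast
  have "l < 0"
    using neg l[of x] mult_nonneg_nonneg[of l "x \<bullet> x"] by fastforce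
  define q where "q = map_poly complex_of_real (p - [:l:])"
  have pos: "poly (p - [:l:]) t \<noteq> 0" if "complex_of_real t \<in> op_spectrum A" for t
    using p[OF that] \<open>l < 0\<close> by simp
  have "bounded_below (cpoly_apply q A)"
  proof (rule bounded_below_cpoly_apply)
    show "A \<in> bounded_operators"
      by (rule selfadjoint_bounded_operators[OF A])
    show "q \<noteq> 0"
      using pos[OF m] by (auto simp: q_def map_poly_eq_0_iff)
    fix z assume z: "poly q z = 0"
    show "bounded_below (\<lambda>x. A x - z *\<^sub>C x)"
    proof (cases "Im z = 0")
      case True
      then have "z = complex_of_real (Re z)"
        by (simp add: complex_eq_iff)
      with z have "poly (p - [:l:]) (Re z) = 0"
        unfolding q_def by (metis of_real_eq_0_iff poly_map_poly_of_real)
      with pos \<open>z = _\<close> have "z \<notin> op_spectrum A"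
        by metis
      then show ?thesis
        by (rule bounded_below_outside_spectrum)
    qed (rule bounded_below_nonreal[OF A])
  qed
  moreover have "cpoly_apply q A = (\<lambda>y. ?T y - l *\<^sub>R y)"
    unfolding q_def
    by (simp add: fun_eq_iff poly_operator_diff poly_operator_const blinfun.diff_left
        blinfun.scaleR_left flip: poly_operator_apply)
  ultimately show False
    using nb by simp
qed

text \<open>Both \<open>c - p\<close> and \<open>c + p\<close> are nonnegative on the spectrum,
  which bounds the quadratic form of \<open>p(A)\<close> and hence its norm. This estimate controls
  limits of polynomials in \<open>A\<close>.\<close>

lemma norm_poly_operator_le:
  assumes A: "selfadjoint A" and "0 \<le> c"
    and p: "\<And>t. complex_of_real t \<in> op_spectrum A \<Longrightarrow> \<bar>poly p t\<bar> \<le> c"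
  shows "norm (poly_operator p A) \<le> c"
proof (rule norm_selfadjoint_le[OF selfadjoint_poly_operator[OF A] \<open>0 \<le> c\<close>])
  fix x
  have "0 \<le> poly_operator ([:c:] - p) A x \<bullet> x" "0 \<le> poly_operator ([:c:] + p) A x \<bullet> x"
    using p by (intro poly_operator_nonneg[OF A]; force simp: abs_le_iff)+
  then show "\<bar>poly_operator p A x \<bullet> x\<bar> \<le> c * (x \<bullet> x)"
    by (simp add: poly_operator_diff poly_operator_add poly_operator_const blinfun.diff_left
        blinfun.add_left blinfun.scaleR_left inner_diff_left inner_add_left abs_le_iff)
qed

section \<open>The spectrum and the numerical range\<close>

text \<open>For \<open>\<delta> \<le> S \<le> K\<close> the operator \<open>1 - S / K\<close> has norm less than 1, so \<open>Sx = y\<close> is a fixed-point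
  equation for a contraction.\<close>

lemma selfadjoint_inverse:
  fixes S :: "'a::chilbert_space \<Rightarrow>\<^sub>L 'a"
  assumes S: "selfadjoint S" and "0 < \<delta>" and ge: "\<And>x. \<delta> * (x \<bullet> x) \<le> S x \<bullet> x"
  obtains R where "R \<in> bounded_operators" and "\<And>x. R (S x) = x" and "\<And>x. S (R x) = x"
proof -
  \<comment> \<open>Large enough for \<open>S \<le> K\<close> and \<open>\<delta> \<le> K\<close>,
    so that \<open>P = 1 - S / K\<close> lies between 0 and
    \<open>k = 1 - \<delta> / K\<close>.\<close>
  define K where "K = norm S + \<delta>"
  define P where "P = id_blinfun - (1 / K) *\<^sub>R S"
  define k where "k = 1 - \<delta> / K"
  have K: "0 < K" "\<delta> \<le> K"
    using \<open>0 < \<delta>\<close> by (simp_all add: K_def add_nonneg_pos)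
  then have k: "0 \<le> k" "k < 1"
    using \<open>0 < \<delta>\<close> by (simp_all add: k_def)
  have le: "S x \<bullet> x \<le> K * (x \<bullet> x)" for x
  proof -
    have "S x \<bullet> x \<le> norm (S x) * norm x"
      by (rule norm_cauchy_schwarz)
    also have "\<dots> \<le> norm S * norm x * norm x"
      by (intro mult_right_mono norm_blinfun) simp
    also have "\<dots> \<le> K * norm x * norm x"
      using \<open>0 < \<delta>\<close> by (intro mult_right_mono) (simp_all add: K_def)
    finally show ?thesis
      by (simp add: power2_eq_square mult.assoc flip: power2_norm_eq_inner)
  qed
  have P: "P x = x - (1 / K) *\<^sub>R S x" for x
    by (simp add: P_def blinfun.diff_left blinfun.scaleR_left)
  have "norm P \<le> k"
  proof (rule norm_selfadjoint_le[OF _ \<open>0 \<le> k\<close>])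
    show "selfadjoint P"
      unfolding P_def by (intro selfadjoint_diff selfadjoint_scaleR selfadjoint_id S)
    fix x
    have "P x \<bullet> x = x \<bullet> x - (S x \<bullet> x) / K"
      by (simp add: P inner_diff_left)
    then show "\<bar>P x \<bullet> x\<bar> \<le> k * (x \<bullet> x)"
      using le[of x] ge[of x] K by (simp add: k_def abs_le_iff field_simps)
  qed
  have sol: "\<exists>!x. S x = y" for y
  proof -
    have "\<exists>!x. P x + (1 / K) *\<^sub>R y = x"
    proof (rule banach_fix_type[OF k], intro allI)
      fix x z
      have "dist (P x + (1 / K) *\<^sub>R y) (P z + (1 / K) *\<^sub>R y) = norm (P (x - z))"
        by (simp add: dist_norm blinfun.diff_right)
      also have "\<dots> \<le> norm P * norm (x - z)"
        by (rule norm_blinfun)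
      also have "\<dots> \<le> k * dist x z"
        using \<open>norm P \<le> k\<close> by (simp add: dist_norm mult_right_mono)
      finally show "dist (P x + (1 / K) *\<^sub>R y) (P z + (1 / K) *\<^sub>R y) \<le> k * dist x z" .
    qed
    moreover have "P x + (1 / K) *\<^sub>R y = x \<longleftrightarrow> S x = y" for x
    proof -
      have "P x + (1 / K) *\<^sub>R y = x \<longleftrightarrow> (1 / K) *\<^sub>R S x = (1 / K) *\<^sub>R y"
        by (auto simp: P algebra_simps)
      then show ?thesis
        using K by simp
    qed
    ultimately show ?thesis
      by simp
  qed
  define g where "g = inv (blinfun_apply S)"
  have "bij (blinfun_apply S)"
    unfolding bij_iff using sol by simp
  then have gS: "g (S x) = x" and Sg: "S (g x) = x" for x
    by (simp_all add: g_def bij_is_inj bij_is_surj surj_f_inv_f)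
  have eqI: "g y = x" if "S x = y" for x y
    using that gS by auto
  have "bounded_linear g"
  proof (rule bounded_linear_intro[where K = "1 / \<delta>"])
    show "g (x + y) = g x + g y" "g (r *\<^sub>R x) = r *\<^sub>R g x" for x y r
      by (rule eqI, simp add: blinfun.add_right blinfun.scaleR_right Sg)+
    fix x
    have "\<delta> * (norm (g x))\<^sup>2 \<le> S (g x) \<bullet> g x"
      using ge[of "g x"] by (simp add: power2_norm_eq_inner)
    also have "\<dots> \<le> norm x * norm (g x)"
      by (simp add: Sg norm_cauchy_schwarz)
    finally have "\<delta> * norm (g x) \<le> norm x"
      by (cases "g x = 0") (simp_all add: power2_eq_square)
    then show "norm (g x) \<le> norm x * (1 / \<delta>)"
      using \<open>0 < \<delta>\<close> by (simp add: pos_le_divide_eq mult.commute)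
  qed
  then have ap: "blinfun_apply (Blinfun g) = g"
    by (rule bounded_linear_Blinfun_apply)
  have "g (c *\<^sub>C x) = c *\<^sub>C g x" for c x
    by (rule eqI) (simp add: bounded_operatorsD[OF selfadjoint_bounded_operators[OF S]] Sg)
  then show thesis
    using gS Sg by (intro that[of "Blinfun g"]) (simp_all add: ap bounded_operators_def)
qed

text \<open>For \<open>t < a\<close> the operator \<open>A - t\<close> is bounded from below by
  \<open>a - t > 0\<close>, hence invertible. For \<open>t > b\<close> the same holds for
  \<open>t - A\<close>, and the inverse is negated.\<close>

lemma spectrum_bounded_between:
  fixes A :: "'a::chilbert_space \<Rightarrow>\<^sub>L 'a"
  assumes A: "selfadjoint A" and ab: "bounded_between a A b"
    and t: "complex_of_real t \<in> op_spectrum A"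
  shows "t \<in> {a..b}"
proof (rule ccontr)
  assume "t \<notin> {a..b}"
  then consider "t < a" | "b < t"
    by fastforce
  then show False
  proof cases
    case 1
    have "(a - t) * (x \<bullet> x) \<le> (A - t *\<^sub>R id_blinfun) x \<bullet> x" for x
      using ab by (simp add: bounded_between_iff[OF A] blinfun.diff_left blinfun.scaleR_left
          inner_diff_left left_diff_distrib)
    moreover have "selfadjoint (A - t *\<^sub>R id_blinfun)"
      by (intro selfadjoint_diff selfadjoint_scaleR selfadjoint_id A)
    ultimately obtain R where "R \<in> bounded_operators"
      "\<And>x. R ((A - t *\<^sub>R id_blinfun) x) = x" "\<And>x. (A - t *\<^sub>R id_blinfun) (R x) = x"
      using selfadjoint_inverse[of "A - t *\<^sub>R id_blinfun" "a - t"] 1 by auto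
    then show False
      using t by (auto simp: op_spectrum_def scaleC_of_real blinfun.diff_left blinfun.scaleR_left)
  next
    case 2
    have "(t - b) * (x \<bullet> x) \<le> (t *\<^sub>R id_blinfun - A) x \<bullet> x" for x
      using ab by (simp add: bounded_between_iff[OF A] blinfun.diff_left blinfun.scaleR_left
          inner_diff_left left_diff_distrib)
    moreover have "selfadjoint (t *\<^sub>R id_blinfun - A)"
      by (intro selfadjoint_diff selfadjoint_scaleR selfadjoint_id A)
    ultimately obtain R where R: "R \<in> bounded_operators"
      "\<And>x. R ((t *\<^sub>R id_blinfun - A) x) = x" "\<And>x. (t *\<^sub>R id_blinfun - A) (R x) = x"
      using selfadjoint_inverse[of "t *\<^sub>R id_blinfun - A" "t - b"] 2 by auto
    have "- R \<in> bounded_operators"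
      using bounded_operators_scaleR[OF R(1), of "-1"] by simp
    moreover have "(- R) (A x - complex_of_real t *\<^sub>C x) = x" for x
      using R(2)[of x]
      by (simp add: scaleC_of_real blinfun.diff_left blinfun.scaleR_left blinfun.minus_left
          blinfun.diff_right)
    moreover have "A ((- R) x) - complex_of_real t *\<^sub>C (- R) x = x" for x
      using R(3)[of x]
      by (simp add: scaleC_of_real blinfun.diff_left blinfun.scaleR_left blinfun.minus_left
          blinfun.minus_right)
    ultimately show False
      using t unfolding op_spectrum_def by blast
  qed
qed

section \<open>Continuous functional calculus\<close>

text \<open>Uniqueness of the limit: two approximating sequences differ by polynomials tending to 0
  uniformly on the spectrum, so their operators differ by a norm-null sequence.\<close>

lemma cfc_eqI:
  fixes A :: "'a::complex_inner \<Rightarrow>\<^sub>L 'a"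
  assumes A: "selfadjoint A"
    and p: "uniform_limit {t. complex_of_real t \<in> op_spectrum A} (\<lambda>k. poly (p k)) f sequentially"
    and T: "(\<lambda>k. poly_operator (p k) A) \<longlonglongrightarrow> T"
  shows "cfc f A = T"
  unfolding cfc_def
proof (rule the_equality)
  let ?\<sigma> = "{t. complex_of_real t \<in> op_spectrum A}"
  fix T'
  assume "\<exists>q. uniform_limit ?\<sigma> (\<lambda>k. poly (q k)) f sequentially \<and>
    (\<lambda>k. poly_operator (q k) A) \<longlonglongrightarrow> T'"
  then obtain q where q: "uniform_limit ?\<sigma> (\<lambda>k. poly (q k)) f sequentially"
    and T': "(\<lambda>k. poly_operator (q k) A) \<longlonglongrightarrow> T'"
    by blast
  have "(\<lambda>k. poly_operator (q k - p k) A) \<longlonglongrightarrow> 0"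
  proof (rule tendstoI)
    fix e :: real assume "0 < e"
    have "uniform_limit ?\<sigma> (\<lambda>k t. poly (q k) t - poly (p k) t) (\<lambda>t. f t - f t) sequentially"
      by (rule uniform_limit_minus[OF q p])
    then have "\<forall>\<^sub>F k in sequentially. \<forall>t\<in>?\<sigma>. dist (poly (q k) t - poly (p k) t) (f t - f t) < e / 2"
      by (rule uniform_limitD) (simp add: \<open>0 < e\<close>)
    then show "\<forall>\<^sub>F k in sequentially. dist (poly_operator (q k - p k) A) 0 < e"
    proof eventually_elim
      case (elim k)
      have "norm (poly_operator (q k - p k) A) \<le> e / 2"
        using elim \<open>0 < e\<close> by (intro norm_poly_operator_le[OF A]) (auto simp: less_imp_le)
      then show ?case
        using \<open>0 < e\<close> by simp
    qed
  qed
  moreover have "(\<lambda>k. poly_operator (q k - p k) A) \<longlonglongrightarrow> T' - T"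
    unfolding poly_operator_diff by (rule tendsto_diff[OF T' T])
  ultimately show "T' = T"
    using LIMSEQ_unique by fastforce
qed (use p T in blast)

text \<open>Weierstrass approximation on all of \<open>[a, b]\<close>, which contains the real
  spectrum, gives a Cauchy sequence of operators by the norm estimate; completeness supplies the
  limit.\<close>

lemma cfc_limit:
  fixes A :: "'a::chilbert_space \<Rightarrow>\<^sub>L 'a"
  assumes A: "selfadjoint A" and ab: "bounded_between a A b" and f: "continuous_on {a..b} f"
  obtains p where "uniform_limit {a..b} (\<lambda>k. poly (p k)) f sequentially"
    and "(\<lambda>k. poly_operator (p k) A) \<longlonglongrightarrow> cfc f A"
proof -
  have "\<exists>p. \<forall>t\<in>{a..b}. \<bar>f t - poly p t\<bar> < e" if "0 < e" for e
  proof -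
    obtain g where "real_polynomial_function g" and g: "\<And>t. t \<in> {a..b} \<Longrightarrow> \<bar>f t - g t\<bar> < e"
      using Stone_Weierstrass_real_polynomial_function[OF compact_Icc f \<open>0 < e\<close>] by blast
    then obtain c n where "g = (\<lambda>t. \<Sum>i\<le>n. c i * t ^ i)"
      by (auto simp: real_polynomial_function_iff_sum)
    then have "poly (\<Sum>i\<le>n. monom (c i) i) = g"
      by (simp add: fun_eq_iff poly_sum poly_monom)
    with g show ?thesis
      by metis
  qed
  then have "\<forall>k. \<exists>p. \<forall>t\<in>{a..b}. \<bar>f t - poly p t\<bar> < inverse (real (Suc k))"
    by simp
  then obtain p where p: "\<And>k t. t \<in> {a..b} \<Longrightarrow> \<bar>f t - poly (p k) t\<bar> < inverse (real (Suc k))"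
    by metis
  have lim: "uniform_limit {a..b} (\<lambda>k. poly (p k)) f sequentially"
  proof (rule uniform_limitI)
    fix e :: real assume "0 < e"
    have "\<forall>\<^sub>F k in sequentially. inverse (real (Suc k)) < e"
      by (rule order_tendstoD(2)[OF LIMSEQ_inverse_real_of_nat \<open>0 < e\<close>])
    then show "\<forall>\<^sub>F k in sequentially. \<forall>t\<in>{a..b}. dist (poly (p k) t) (f t) < e"
    proof eventually_elim
      case (elim k)
      show ?case
        using p[of _ k] elim by (fastforce simp: dist_real_def abs_minus_commute)
    qed
  qed
  have "Cauchy (\<lambda>k. poly_operator (p k) A)"
  proof (rule metric_CauchyI)
    fix e :: real assume "0 < e"
    obtain N where N: "inverse (real (Suc N)) < e / 3"
      using reals_Archimedean[of "e / 3"] \<open>0 < e\<close> by auto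
    have "dist (poly_operator (p i) A) (poly_operator (p j) A) < e" if "N \<le> i" "N \<le> j" for i j
    proof -
      have inv: "inverse (real (Suc k)) < e / 3" if "N \<le> k" for k
      proof -
        have "inverse (real (Suc k)) \<le> inverse (real (Suc N))"
          using that by (intro le_imp_inverse_le) simp_all
        then show ?thesis
          using N by linarith
      qed
      \<comment> \<open>Two approximation errors of \<open>e / 3\<close> each, leaving room for the
        strict inequality.\<close>
      have "norm (poly_operator (p i - p j) A) \<le> 2 * e / 3"
      proof (rule norm_poly_operator_le[OF A])
        fix t assume "complex_of_real t \<in> op_spectrum A"
        then have "t \<in> {a..b}"
          by (rule spectrum_bounded_between[OF A ab])
        from p[OF this, of i] p[OF this, of j] show "\<bar>poly (p i - p j) t\<bar> \<le> 2 * e / 3"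
          using inv[OF \<open>N \<le> i\<close>] inv[OF \<open>N \<le> j\<close>] unfolding poly_diff by linarith
      qed (use \<open>0 < e\<close> in simp)
      then show ?thesis
        using \<open>0 < e\<close> by (simp add: dist_norm poly_operator_diff)
    qed
    then show "\<exists>N. \<forall>i\<ge>N. \<forall>j\<ge>N. dist (poly_operator (p i) A) (poly_operator (p j) A) < e"
      by blast
  qed
  then obtain T where T: "(\<lambda>k. poly_operator (p k) A) \<longlonglongrightarrow> T"
    using Cauchy_convergent convergent_def by blast
  have "cfc f A = T"
    using spectrum_bounded_between[OF A ab]
    by (intro cfc_eqI[OF A _ T] uniform_limit_on_subset[OF lim]) auto
  with lim T show thesis
    using that by blast
qed

lemma selfadjoint_cfc:
  fixes A :: "'a::chilbert_space \<Rightarrow>\<^sub>L 'a"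
  assumes "selfadjoint A" and "bounded_between a A b" and "continuous_on {a..b} f"
  shows "selfadjoint (cfc f A)"
proof -
  obtain p where "(\<lambda>k. poly_operator (p k) A) \<longlonglongrightarrow> cfc f A"
    using cfc_limit[OF assms] by blast
  then show ?thesis
    using closed_sequentially[OF closed_selfadjoint, of "\<lambda>k. poly_operator (p k) A"]
    by (simp add: selfadjoint_poly_operator assms(1))
qed

lemma cfc_poly:
  assumes "selfadjoint A"
  shows "cfc (poly p) A = poly_operator p A"
  by (rule cfc_eqI[OF assms, where p = "\<lambda>_. p"]) (simp_all add: uniform_limit_const)

text \<open>The approximants of \<open>f\<close> and \<open>g\<close> need not be ordered. Once both
  errors are below \<open>e / 2\<close>, however, \<open>q k - p k + e\<close> is nonnegative on the
  spectrum; the slack \<open>e\<close> is removed after the limit.\<close>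

lemma cfc_mono:
  fixes A :: "'a::chilbert_space \<Rightarrow>\<^sub>L 'a"
  assumes A: "selfadjoint A" and ab: "bounded_between a A b"
    and f: "continuous_on {a..b} f" and g: "continuous_on {a..b} g"
    and le: "\<And>t. t \<in> {a..b} \<Longrightarrow> f t \<le> g t"
  shows "cfc f A \<preceq> cfc g A"
  unfolding operator_le_iff
proof (intro conjI allI)
  obtain p where p: "uniform_limit {a..b} (\<lambda>k. poly (p k)) f sequentially"
    and pA: "(\<lambda>k. poly_operator (p k) A) \<longlonglongrightarrow> cfc f A"
    using cfc_limit[OF A ab f] by blast
  obtain q where q: "uniform_limit {a..b} (\<lambda>k. poly (q k)) g sequentially"
    and qA: "(\<lambda>k. poly_operator (q k) A) \<longlonglongrightarrow> cfc g A"
    using cfc_limit[OF A ab g] by blast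
  fix x
  have lim: "(\<lambda>k. P k x \<bullet> x) \<longlonglongrightarrow> T x \<bullet> x" if "P \<longlonglongrightarrow> T" for P and T :: "'a \<Rightarrow>\<^sub>L 'a"
    by (intro tendsto_inner blinfun.tendsto that tendsto_const)
  have le_eps: "cfc f A x \<bullet> x \<le> cfc g A x \<bullet> x + e * (x \<bullet> x)" if "0 < e" for e
  proof (rule tendsto_le[OF trivial_limit_sequentially])
    show "(\<lambda>k. poly_operator (q k) A x \<bullet> x + e * (x \<bullet> x)) \<longlonglongrightarrow> cfc g A x \<bullet> x + e * (x \<bullet> x)"
      by (intro tendsto_add lim qA tendsto_const)
    show "(\<lambda>k. poly_operator (p k) A x \<bullet> x) \<longlonglongrightarrow> cfc f A x \<bullet> x"
      by (rule lim[OF pA])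
    have "0 < e / 2"
      using that by simp
    from uniform_limitD[OF p this] uniform_limitD[OF q this]
    show "\<forall>\<^sub>F k in sequentially.
      poly_operator (p k) A x \<bullet> x \<le> poly_operator (q k) A x \<bullet> x + e * (x \<bullet> x)"
    proof eventually_elim
      case (elim k)
      have "0 \<le> poly_operator (q k - p k + [:e:]) A x \<bullet> x"
      proof (rule poly_operator_nonneg[OF A])
        fix t assume "complex_of_real t \<in> op_spectrum A"
        then have t: "t \<in> {a..b}"
          by (rule spectrum_bounded_between[OF A ab])
        then have "\<bar>poly (p k) t - f t\<bar> < e / 2" "\<bar>poly (q k) t - g t\<bar> < e / 2"
          using elim by (auto simp: dist_real_def)
        then show "0 \<le> poly (q k - p k + [:e:]) t"
          using le[OF t] unfolding poly_add poly_diff poly_pCons poly_0 by linarith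
      qed
      then show ?case
        by (simp add: poly_operator_add poly_operator_diff poly_operator_const blinfun.add_left
            blinfun.diff_left blinfun.scaleR_left inner_add_left inner_diff_left)
    qed
  qed
  show "cfc f A x \<bullet> x \<le> cfc g A x \<bullet> x"
  proof (rule field_le_epsilon)
    fix d :: real assume "0 < d"
    show "cfc f A x \<bullet> x \<le> cfc g A x \<bullet> x + d"
    proof (cases "x = 0")
      case False
      then show ?thesis
        using le_eps[of "d / (x \<bullet> x)"] \<open>0 < d\<close> by simp
    qed (use \<open>0 < d\<close> in simp)
  qed
qed (use selfadjoint_cfc[OF A ab] f g in auto)

lemma cfc_affine:
  assumes "selfadjoint A"
  shows "cfc (\<lambda>t. c * t + d) A = c *\<^sub>R A + d *\<^sub>R id_blinfun"
proof -
  have "(\<lambda>t. c * t + d) = poly [:d, c:]"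
    by (simp add: fun_eq_iff)
  then show ?thesis
    by (simp only: cfc_poly[OF assms] poly_operator_affine add.commute)
qed

lemma cfc_le_affine:
  fixes A :: "'a::chilbert_space \<Rightarrow>\<^sub>L 'a"
  assumes A: "selfadjoint A" and "bounded_between a A b" and "continuous_on {a..b} f"
    and "\<And>t. t \<in> {a..b} \<Longrightarrow> f t \<le> c * t + d"
  shows "cfc f A x \<bullet> x \<le> c * (A x \<bullet> x) + d * (x \<bullet> x)"
proof -
  have "cfc f A \<preceq> cfc (\<lambda>t. c * t + d) A"
    using assms by (intro cfc_mono) (auto intro: continuous_intros)
  then show ?thesis
    by (simp add: cfc_affine[OF A] operator_le_iff blinfun.add_left blinfun.scaleR_left
        inner_add_left)
qed

lemma affine_le_cfc:
  fixes A :: "'a::chilbert_space \<Rightarrow>\<^sub>L 'a"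
  assumes A: "selfadjoint A" and "bounded_between a A b" and "continuous_on {a..b} f"
    and "\<And>t. t \<in> {a..b} \<Longrightarrow> c * t + d \<le> f t"
  shows "c * (A x \<bullet> x) + d * (x \<bullet> x) \<le> cfc f A x \<bullet> x"
proof -
  have "cfc (\<lambda>t. c * t + d) A \<preceq> cfc f A"
    using assms by (intro cfc_mono) (auto intro: continuous_intros)
  then show ?thesis
    by (simp add: cfc_affine[OF A] operator_le_iff blinfun.add_left blinfun.scaleR_left
        inner_add_left)
qed

section \<open>Convex functions of operators with separated spectra\<close>

lemma bounded_between_add:
  assumes A: "selfadjoint A" and B: "selfadjoint B"
    and "bounded_between a A b" and "bounded_between a' B b'"
  shows "bounded_between (a + a') (A + B) (b + b')"
  using assms(3,4)
  by (simp add: bounded_between_iff A B selfadjoint_add blinfun.add_left inner_add_left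
      distrib_right add_mono)

lemma bounded_between_scaleR:
  assumes A: "selfadjoint A" and "bounded_between a A b" and "0 \<le> r"
  shows "bounded_between (r * a) (r *\<^sub>R A) (r * b)"
  using assms(2,3)
  by (simp add: bounded_between_iff A selfadjoint_scaleR blinfun.scaleR_left mult.assoc
      mult_left_mono)

text \<open>Inside \<open>[p, q]\<close> this is convexity; outside it is monotonicity of secant
  slopes, comparing the chord with the secant from \<open>t\<close> to the far endpoint.\<close>

lemma convex_on_chord:
  fixes f :: "real \<Rightarrow> real"
  assumes f: "convex_on I f" and I: "p \<in> I" "q \<in> I" and "p < q"
  obtains c d where "\<And>t. t \<in> {p..q} \<Longrightarrow> f t \<le> c * t + d"
    and "\<And>t. t \<in> I \<Longrightarrow> t \<notin> {p..q} \<Longrightarrow> c * t + d \<le> f t"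
proof -
  define c where "c = (f q - f p) / (q - p)"
  have c: "c = (f p - f q) / (p - q)"
    by (simp add: c_def minus_divide_divide[of "f p - f q", symmetric])
  have q: "c * (q - p) = f q - f p"
    using \<open>p < q\<close> by (simp add: c_def)
  have "{p..q} \<subseteq> I"
    using closed_segment_subset[OF I convex_on_imp_convex[OF f]] \<open>p < q\<close>
    by (simp add: closed_segment_eq_real_ivl)
  then have "convex_on {p..q} f"
    by (rule convex_on_subset[OF f]) simp
  then have in_le: "f t \<le> c * (t - p) + f p" if "t \<in> {p..q}" for t
    using convex_onD_Icc'[of p q f t] that by (simp add: c_def)
  have out: "c * (t - p) + f p \<le> f t" if "t \<in> I" and t: "t \<notin> {p..q}" for t
  proof -
    consider "t < p" | "q < t"
      using t by fastforce
    then show ?thesis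
    proof cases
      case 1
      have "(f t - f q) / (t - q) \<le> c"
        unfolding c by (rule convex_on_slope_le(2)[OF f \<open>t \<in> I\<close> \<open>q \<in> I\<close> 1 \<open>p < q\<close>])
      then show ?thesis
        using 1 \<open>p < q\<close> q by (simp add: neg_divide_le_eq algebra_simps)
    next
      case 2
      have "c \<le> (f p - f t) / (p - t)"
        unfolding c by (rule convex_on_slope_le(1)[OF f \<open>p \<in> I\<close> \<open>t \<in> I\<close> \<open>p < q\<close> 2])
      then show ?thesis
        using 2 \<open>p < q\<close> by (simp add: neg_le_divide_eq algebra_simps)
    qed
  qed
  from in_le out show thesis
    by (intro that[of c "f p - c * p"]) (simp_all add: algebra_simps)
qed

theorem corollary2p1:
  fixes A B :: "'a::chilbert_space \<Rightarrow>\<^sub>L 'a"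
    and n N m M :: real
    and f :: "real \<Rightarrow> real"
  assumes "positive_operator A" and "positive_operator B"
    and "0 < n" and "n < N" and "0 < m" and "m < M"
    and "bounded_between n A N" and "bounded_between m B M"
    and "{(n + m) / 2..(N + M) / 2} \<inter> {n..N} = {}"
    and "{(n + m) / 2..(N + M) / 2} \<inter> {m..M} = {}"
    and "convex_on {0<..} f" and "\<And>t. 0 < t \<Longrightarrow> 0 \<le> f t"
  shows "2 *\<^sub>R cfc f (A + B) \<preceq> cfc f (2 *\<^sub>R A) + cfc f (2 *\<^sub>R B)
    \<and> cfc f ((1 / 2) *\<^sub>R (A + B)) \<preceq> (1 / 2) *\<^sub>R (cfc f A + cfc f B)
    \<and> ((\<forall>t>0. f (2 * t) \<le> 2 * f t) \<longrightarrow> cfc f (A + B) \<preceq> cfc f A + cfc f B)"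
proof -
  have A: "selfadjoint A" and B: "selfadjoint B"
    using assms by (simp_all add: positive_operator_selfadjoint)
  note pos = \<open>0 < n\<close> \<open>n < N\<close> \<open>0 < m\<close> \<open>m < M\<close>
  \<comment> \<open>A convex function on an open interval is continuous, so \<open>cfc f\<close> is
    meaningful for every operator involved, their spectra being bounded away from 0.\<close>
  have "continuous_on {0<..} f"
    using convex_on_continuous[OF _ assms(11)] by simp
  then have cont: "continuous_on {a..b} f" if "0 < a" for a b
    by (rule continuous_on_subset) (use that in auto)
  have outA: "t \<notin> {(n + m) / 2..(N + M) / 2}" if "t \<in> {n..N}" for t
    using assms(9) that by blast
  have outB: "t \<notin> {(n + m) / 2..(N + M) / 2}" if "t \<in> {m..M}" for t
    using assms(10) that by blast

  note [intro] = selfadjoint_add selfadjoint_scaleR A B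
  have bdA: "bounded_between n A N" and bdB: "bounded_between m B M"
    by fact+
  have bdS: "bounded_between (n + m) (A + B) (N + M)"
    by (intro bounded_between_add A B bdA bdB)
  have bd2A: "bounded_between (2 * n) (2 *\<^sub>R A) (2 * N)"
    and bd2B: "bounded_between (2 * m) (2 *\<^sub>R B) (2 * M)"
    and bdM: "bounded_between (1 / 2 * (n + m)) ((1 / 2) *\<^sub>R (A + B)) (1 / 2 * (N + M))"
    by (intro bounded_between_scaleR selfadjoint_add A B bdA bdB bdS; simp)+
  have cA: "continuous_on {n..N} f" and cB: "continuous_on {m..M} f"
    and cS: "continuous_on {n + m..N + M} f"
    and c2A: "continuous_on {2 * n..2 * N} f" and c2B: "continuous_on {2 * m..2 * M} f"
    and cM: "continuous_on {1 / 2 * (n + m)..1 / 2 * (N + M)} f"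
    using pos by (auto intro!: cont)
  have sA: "selfadjoint (cfc f A)" and sB: "selfadjoint (cfc f B)"
    and sS: "selfadjoint (cfc f (A + B))"
    and s2A: "selfadjoint (cfc f (2 *\<^sub>R A))" and s2B: "selfadjoint (cfc f (2 *\<^sub>R B))"
    and sM: "selfadjoint (cfc f ((1 / 2) *\<^sub>R (A + B)))"
    using selfadjoint_cfc[OF A bdA cA] selfadjoint_cfc[OF B bdB cB]
      selfadjoint_cfc[OF _ bdS cS] selfadjoint_cfc[OF _ bd2A c2A] selfadjoint_cfc[OF _ bd2B c2B]
      selfadjoint_cfc[OF _ bdM cM] by auto

  have mid: "cfc f ((1 / 2) *\<^sub>R (A + B)) \<preceq> (1 / 2) *\<^sub>R (cfc f A + cfc f B)"
    unfolding operator_le_iff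
  proof (intro conjI allI)
    fix x
    obtain c d where le: "\<And>t. t \<in> {(n + m) / 2..(N + M) / 2} \<Longrightarrow> f t \<le> c * t + d"
      and ge: "\<And>t. t \<in> {0<..} \<Longrightarrow> t \<notin> {(n + m) / 2..(N + M) / 2} \<Longrightarrow> c * t + d \<le> f t"
      using convex_on_chord[OF assms(11), of "(n + m) / 2" "(N + M) / 2"] pos by auto
    have "cfc f ((1 / 2) *\<^sub>R (A + B)) x \<bullet> x
      \<le> c * (((1 / 2) *\<^sub>R (A + B)) x \<bullet> x) + d * (x \<bullet> x)"
      using le by (intro cfc_le_affine[OF _ bdM cM]) auto
    moreover have "c * (A x \<bullet> x) + d * (x \<bullet> x) \<le> cfc f A x \<bullet> x"
      using pos by (intro affine_le_cfc[OF A bdA cA] ge outA) auto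
    moreover have "c * (B x \<bullet> x) + d * (x \<bullet> x) \<le> cfc f B x \<bullet> x"
      using pos by (intro affine_le_cfc[OF B bdB cB] ge outB) auto
    ultimately show "cfc f ((1 / 2) *\<^sub>R (A + B)) x \<bullet> x
      \<le> ((1 / 2) *\<^sub>R (cfc f A + cfc f B)) x \<bullet> x"
      by (simp add: blinfun.scaleR_left blinfun.add_left inner_add_left algebra_simps)
  qed (use sA sB sM in auto)

  \<comment> \<open>\<open>[n + m, N + M]\<close> contains the spectrum of \<open>A + B\<close>, and
    by the hypotheses scaled by 2 it misses \<open>[2 * n, 2 * N]\<close> and
    \<open>[2 * m, 2 * M]\<close>. This chord serves both remaining inequalities.\<close>
  obtain c d where le: "\<And>t. t \<in> {n + m..N + M} \<Longrightarrow> f t \<le> c * t + d"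
    and ge: "\<And>t. t \<in> {0<..} \<Longrightarrow> t \<notin> {n + m..N + M} \<Longrightarrow> c * t + d \<le> f t"
    using convex_on_chord[OF assms(11), of "n + m" "N + M"] pos by auto
  have ge': "c * t + d \<le> f t" if "t / 2 \<in> {n..N} \<or> t / 2 \<in> {m..M}" for t
  proof (rule ge)
    show "t \<in> {0<..}"
      using that pos by auto
    show "t \<notin> {n + m..N + M}"
      using that outA[of "t / 2"] outB[of "t / 2"] by auto
  qed
  have S: "cfc f (A + B) x \<bullet> x \<le> c * ((A + B) x \<bullet> x) + d * (x \<bullet> x)" for x
    using le by (intro cfc_le_affine[OF _ bdS cS]) auto

  have dbl: "2 *\<^sub>R cfc f (A + B) \<preceq> cfc f (2 *\<^sub>R A) + cfc f (2 *\<^sub>R B)"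
    unfolding operator_le_iff
  proof (intro conjI allI)
    fix x
    have "c * ((2 *\<^sub>R A) x \<bullet> x) + d * (x \<bullet> x) \<le> cfc f (2 *\<^sub>R A) x \<bullet> x"
      using ge' by (intro affine_le_cfc[OF _ bd2A c2A]) auto
    moreover have "c * ((2 *\<^sub>R B) x \<bullet> x) + d * (x \<bullet> x) \<le> cfc f (2 *\<^sub>R B) x \<bullet> x"
      using ge' by (intro affine_le_cfc[OF _ bd2B c2B]) auto
    ultimately show "(2 *\<^sub>R cfc f (A + B)) x \<bullet> x \<le> (cfc f (2 *\<^sub>R A) + cfc f (2 *\<^sub>R B)) x \<bullet> x"
      using S[of x] by (simp add: blinfun.scaleR_left blinfun.add_left inner_add_left algebra_simps)
  qed (use s2A s2B sS in auto)

  have "cfc f (A + B) \<preceq> cfc f A + cfc f B" if sub: "\<forall>t>0. f (2 * t) \<le> 2 * f t"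
    unfolding operator_le_iff
  proof (intro conjI allI)
    fix x
    \<comment> \<open>The chord bound at \<open>2 * t\<close> and
      \<open>f (2 * t) \<le> 2 * f t\<close>, halved. The constants \<open>d / 2\<close> for
      \<open>A\<close> and \<open>B\<close> add up to the \<open>d\<close> in the bound for
      \<open>A + B\<close>.\<close>
    have half: "c * t + d / 2 \<le> f t" if "t \<in> {n..N} \<or> t \<in> {m..M}" for t
    proof -
      have "0 < t"
        using that pos by auto
      then show ?thesis
        using ge'[of "2 * t"] sub[rule_format, of t] that by auto
    qed
    have "c * (A x \<bullet> x) + d / 2 * (x \<bullet> x) \<le> cfc f A x \<bullet> x"
      using half by (intro affine_le_cfc[OF A bdA cA]) auto
    moreover have "c * (B x \<bullet> x) + d / 2 * (x \<bullet> x) \<le> cfc f B x \<bullet> x"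
      using half by (intro affine_le_cfc[OF B bdB cB]) auto
    ultimately show "cfc f (A + B) x \<bullet> x \<le> (cfc f A + cfc f B) x \<bullet> x"
      using S[of x] by (simp add: blinfun.add_left inner_add_left algebra_simps)
  qed (use sA sB sS in auto)
  with mid dbl show ?thesis
    by blast
qed

end
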